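(* Let $\mathcal H$ be a real Hilbert space, let $A_1,A_2:\mathcal H\to 2^{\mathcal H}$ be maximal monotone, and let $\lambda_1,\lambda_2>0$ with $\lambda_1+\lambda_2=1$. Let $J_A:=\lambda_1J_{A_1}+\lambda_2J_{A_2}$, $E:=\operatorname{Fix}(J_{A_1/\lambda_2}J_{A_2/\lambda_1})$ and $F:=\operatorname{Fix}(J_{A_2/\lambda_1}J_{A_1/\lambda_2})$. Let $u^*:=J_{(A_1/\lambda_2)^{-1}+\widetilde{A_2/\lambda_1}}(0)$, assumed to be well defined, i.e. $u^*$ is the (necessarily unique) point with $0\in u^*+(A_1/\lambda_2)^{-1}(u^* )+\widetilde{A_2/\lambda_1}(u^* )$. Then: (i) The mapping $$H_1:E\to\operatorname{Fix}J_A:\ x\mapsto \lambda_1x+\lambda_2J_{A_2/\lambda_1}x=x+\lambda_2u^*$$ (in particular the two expressions agree on $E$) is a homeomorphism, and $H_1^{-1}:\operatorname{Fix}J_A\to E$ is given by $H_1^{-1}(z)=J_{A_1}(z)$. Hence $\operatorname{Fix}J_A=E+\lambda_2u^*$. (ii) The mapping $$H_2:F\to\operatorname{Fix}J_A:\ y\mapsto \lambda_1J_{A_1/\lambda_2}y+\lambda_2y=-\lambda_1u^*+y$$ (in particular the two expressions agree on $F$) is a homeomorphism, and $H_2^{-1}:\operatorname{Fix}J_A\to F$ is given by $H_2^{-1}(z)=J_{A_2}(z)$. Hence $\operatorname{Fix}J_A=F-\lambda_1u^*$.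
   Context: For a set-valued operator $B:\mathcal H\to2^{\mathcal H}$, the resolvent is $J_B:=(B+\operatorname{Id})^{-1}$; if $B$ is maximal monotone, $J_B$ is single-valued with full domain and is regarded as a map $\mathcal H\to\mathcal H$. $B/\lambda$ denotes $x\mapsto\{u/\lambda: u\in Bx\}$. $B^{-1}$ is the set-valued inverse, and $\widetilde B:=(-\operatorname{Id})\circ B^{-1}\circ(-\operatorname{Id})$, i.e. $\widetilde B(x)=-B^{-1}(-x)$. $\operatorname{Fix}T:=\{x: Tx=x\}$. A homeomorphism is a continuous bijection with continuous inverse; subsets of $\mathcal H$ carry the norm topology. *)

theory Defs
  imports "HOL-Analysis.Analysis" "HOL-Library.Set_Algebras"
begin

text \<open>
  A set-valued operator on \<open>H\<close> is a function \<open>'h \<Rightarrow> 'h set\<close>; its domain may be a proper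
  subset of the space, since values may be empty. Sums of values are Minkowski sums,
  and \<open>B \<le> C\<close> on operators is inclusion of graphs.
\<close>

definition monotone_op :: "('h::real_inner \<Rightarrow> 'h set) \<Rightarrow> bool" where
  "monotone_op B \<longleftrightarrow> (\<forall>x y. \<forall>u\<in>B x. \<forall>v\<in>B y. 0 \<le> inner (x - y) (u - v))"

definition maximal_monotone :: "('h::real_inner \<Rightarrow> 'h set) \<Rightarrow> bool" where
  "maximal_monotone B \<longleftrightarrow> monotone_op B \<and> (\<forall>C. monotone_op C \<and> B \<le> C \<longrightarrow> C = B)"

definition op_inverse :: "('h \<Rightarrow> 'h set) \<Rightarrow> 'h \<Rightarrow> 'h set" where
  "op_inverse B u = {x. u \<in> B x}"

definition op_plus :: "('h::plus \<Rightarrow> 'h set) \<Rightarrow> ('h \<Rightarrow> 'h set) \<Rightarrow> 'h \<Rightarrow> 'h set" where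
  "op_plus B C x = B x + C x"

definition op_divide :: "('h::real_vector \<Rightarrow> 'h set) \<Rightarrow> real \<Rightarrow> 'h \<Rightarrow> 'h set" where
  "op_divide B c x = (\<lambda>u. u /\<^sub>R c) ` B x"

definition op_tilde :: "('h::ab_group_add \<Rightarrow> 'h set) \<Rightarrow> 'h \<Rightarrow> 'h set" where
  "op_tilde B x = uminus ` op_inverse B (- x)"

definition resolvent :: "('h::plus \<Rightarrow> 'h set) \<Rightarrow> 'h \<Rightarrow> 'h set" where
  "resolvent B = op_inverse (op_plus B (\<lambda>x. {x}))"

text \<open>
  The resolvent regarded as a map. Its value is unspecified at points where
  \<^term>\<open>resolvent B\<close> is not a singleton.
\<close>

definition resolvent_map :: "('h::plus \<Rightarrow> 'h set) \<Rightarrow> 'h \<Rightarrow> 'h" where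
  "resolvent_map B x = the_elem (resolvent B x)"

definition Fix :: "('h \<Rightarrow> 'h) \<Rightarrow> 'h set" where
  "Fix T = {x. T x = x}"

end

theory Submission
  imports Defs
begin

text \<open>
  Write \<open>B\<^sub>1 = A\<^sub>1/\<lambda>\<^sub>2\<close> and \<open>B\<^sub>2 = A\<^sub>2/\<lambda>\<^sub>1\<close>. Once resolvents are known to be single-valued with
  full domain, \<open>p = J\<^sub>B x\<close> just means \<open>x - p \<in> B p\<close>, and everything becomes an exchange of
  inclusions. A point \<open>x \<in> E\<close> with \<open>y = J\<^bsub>B\<^sub>2\<^esub> x\<close> satisfies \<open>y - x \<in> B\<^sub>1 x\<close> and
  \<open>x - y \<in> B\<^sub>2 y\<close>. These two inclusions say that \<open>w = y - x\<close> solves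
  \<open>0 \<in> w + B\<^sub>1\<inverse> w - B\<^sub>2\<inverse> (- w)\<close>; the operator on the right is strongly monotone, so the
  displacement \<open>w\<close> is the same vector \<open>u\<^sup>*\<close> for every \<open>x \<in> E\<close>. The same two inclusions, scaled back
  by \<open>\<lambda>\<^sub>2\<close> and \<open>\<lambda>\<^sub>1\<close>, say that \<open>z = \<lambda>\<^sub>1 x + \<lambda>\<^sub>2 y\<close> has \<open>J\<^bsub>A\<^sub>1\<^esub> z = x\<close> and
  \<open>J\<^bsub>A\<^sub>2\<^esub> z = y\<close>, because \<open>z - x = \<lambda>\<^sub>2 (y - x)\<close> and \<open>z - y = \<lambda>\<^sub>1 (x - y)\<close>. Hence \<open>z\<close> is a
  fixed point of \<open>J\<^sub>A\<close>, and reading the argument backwards recovers \<open>x \<in> E\<close> from any fixed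
  point (lemma \<open>Fix_average_homeomorphism\<close>). Both directions are continuous, one being a translation and
  the other a nonexpansive resolvent. Exchanging the two operators, the two weights and the sign of
  \<open>u\<^sup>*\<close> turns the first half of the theorem into the second.

  The one deep ingredient is Minty's theorem, that the resolvent of a maximal monotone operator has
  full domain (lemmas \<open>Minty_zero\<close> and \<open>Minty\<close>). It is obtained by
  minimising the Fitzpatrick function plus half the squared norm on \<open>H \<times> H\<close>: strong
  convexity and completeness give a minimiser without any weak compactness, and the optimality
  condition at the minimiser, combined with maximality, exhibits the required point.
\<close>

section \<open>Minimising a convex function plus half the squared norm\<close>

text \<open>
  The set \<open>S\<close> plays the role of the epigraph of a closed convex function \<open>f\<close>. The function
  \<open>f + \<parallel>\<cdot>\<parallel>\<^sup>2/2\<close> is strongly convex, so by the parallelogram identity its minimising sequences are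
  Cauchy. The conclusion is the first-order condition \<open>-p \<in> \<partial>f(p)\<close> at the minimiser. Working with
  the epigraph avoids extended real values.
\<close>

lemma epigraph_minimiser:
  fixes S :: "('a::{real_inner, complete_space} \<times> real) set"
  assumes "closed S" and "convex S" and "S \<noteq> {}"
    and bound: "\<And>p t. (p, t) \<in> S \<Longrightarrow> b \<le> t + inner p p / 2"
  obtains p t where "(p, t) \<in> S" and "\<And>q s. (q, s) \<in> S \<Longrightarrow> t + inner p p \<le> s + inner p q"
proof -
  define g :: "'a \<times> real \<Rightarrow> real" where "g = (\<lambda>(p, t). t + inner p p / 2)"
  define m where "m = Inf (g ` S)"
  have bdd: "bdd_below (g ` S)"
    using bound by (intro bdd_belowI[of _ b]) (auto simp: g_def)
  have m_le: "m \<le> g a" if "a \<in> S" for a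
    unfolding m_def using bdd that by (simp add: cInf_lower)
  have "\<exists>a\<in>S. g a < m + 1 / real (Suc n)" for n
  proof -
    have "Inf (g ` S) < m + 1 / real (Suc n)" by (simp add: m_def)
    then show ?thesis using bdd assms(3) by (subst (asm) cInf_less_iff) auto
  qed
  then obtain \<sigma> where \<sigma>S: "\<And>n. \<sigma> n \<in> S" and \<sigma>g: "\<And>n. g (\<sigma> n) < m + 1 / real (Suc n)"
    by metis
  define P where "P n = fst (\<sigma> n)" for n
  define T where "T n = snd (\<sigma> n)" for n
  have PT: "(P n, T n) \<in> S" and gPT: "g (\<sigma> n) = T n + inner (P n) (P n) / 2" for n
    using \<sigma>S[of n] by (simp_all add: P_def T_def g_def case_prod_beta)
  \<comment> \<open>Strong convexity: \<open>m\<close> bounds \<open>g\<close> at the midpoint, where the parallelogram identity gains an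
    eighth of the squared distance.\<close>
  have close: "(norm (P n - P k))\<^sup>2 \<le> 4 * (1 / real (Suc n) + 1 / real (Suc k))" for n k
  proof -
    have "(1/2) *\<^sub>R (P n, T n) + (1/2) *\<^sub>R (P k, T k) \<in> S"
      using assms(2) PT by (intro convexD) auto
    from m_le[OF this]
    have "m \<le> (g (\<sigma> n) + g (\<sigma> k)) / 2 - (norm (P n - P k))\<^sup>2 / 8"
      unfolding gPT by (simp add: g_def power2_norm_eq_inner inner_simps inner_commute field_simps)
    with \<sigma>g[of n] \<sigma>g[of k] show ?thesis by argo
  qed
  have "Cauchy P"
  proof (rule metric_CauchyI)
    fix e :: real assume "0 < e"
    then obtain N :: nat where N: "8 / e\<^sup>2 < real N" using reals_Archimedean2 by blast
    have "dist (P n) (P k) < e" if "N \<le> n" "N \<le> k" for n k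
    proof -
      have N0: "0 < real N" using N \<open>0 < e\<close> by (smt (verit) divide_pos_pos zero_less_power)
      have "1 / real (Suc n) \<le> 1 / real N" "1 / real (Suc k) \<le> 1 / real N"
        using that N0 by (auto intro!: divide_left_mono)
      with close[of n k] have "(norm (P n - P k))\<^sup>2 \<le> 8 / real N" by simp
      also have "\<dots> < e\<^sup>2" using N N0 \<open>0 < e\<close> by (simp add: field_simps)
      finally show ?thesis using \<open>0 < e\<close> by (simp add: dist_norm power2_less_imp_less)
    qed
    then show "\<exists>M. \<forall>m\<ge>M. \<forall>n\<ge>M. dist (P m) (P n) < e" by blast
  qed
  then obtain p where p: "P \<longlonglongrightarrow> p" using Cauchy_convergent convergent_def by blast
  have "(\<lambda>n. g (\<sigma> n)) \<longlonglongrightarrow> m"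
  proof (rule tendsto_sandwich[where f = "\<lambda>_. m"])
    show "(\<lambda>n. m + 1 / real (Suc n)) \<longlonglongrightarrow> m"
      using tendsto_add[OF tendsto_const[of m] LIMSEQ_inverse_real_of_nat]
      by (simp add: inverse_eq_divide)
  qed (use m_le \<sigma>S less_imp_le[OF \<sigma>g] in \<open>auto simp del: of_nat_Suc\<close>)
  from tendsto_diff[OF this tendsto_divide[OF tendsto_inner[OF p p] tendsto_const[of 2]]]
  have T: "T \<longlonglongrightarrow> m - inner p p / 2" by (simp add: gPT)
  define t where "t = m - inner p p / 2"
  have pt: "(p, t) \<in> S"
    unfolding t_def by (rule closed_sequentially[OF assms(1) PT tendsto_Pair[OF p T]])
  show ?thesis
  proof (rule that[OF pt])
    fix q s assume qs: "(q, s) \<in> S"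
    \<comment> \<open>\<open>d\<close> is the one-sided derivative of the objective along the segment towards \<open>(q, s)\<close>, and
      the inequality below is the difference quotient before the limit \<open>e \<rightarrow> 0\<close>.\<close>
    define d where "d = s - t + inner p (q - p)"
    have d: "0 \<le> d + e * (inner (q - p) (q - p) / 2)" if "0 < e" "e < 1" for e
    proof -
      have "(1 - e) *\<^sub>R (p, t) + e *\<^sub>R (q, s) \<in> S"
        using assms(2) pt qs that by (intro convexD) auto
      from m_le[OF this] have "0 \<le> e * (d + e * (inner (q - p) (q - p) / 2))"
        by (simp add: g_def t_def d_def inner_add inner_diff inner_commute field_simps)
      with that show ?thesis by (simp add: zero_le_mult_iff)
    qed
    have "((\<lambda>e. d + e * (inner (q - p) (q - p) / 2)) \<longlongrightarrow> d + 0 * (inner (q - p) (q - p) / 2))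
        (at_right 0)"
      by (intro tendsto_intros)
    moreover have "\<forall>\<^sub>F e::real in at_right 0. e < 1 \<and> 0 < e"
      by (auto simp: eventually_at_right_field intro: exI[of _ 1])
    then have "\<forall>\<^sub>F e in at_right 0. 0 \<le> d + e * (inner (q - p) (q - p) / 2)"
      by (rule eventually_mono) (use d in auto)
    ultimately have "0 \<le> d" using tendsto_lowerbound by (fastforce simp: trivial_limit_at_right_real)
    then show "t + inner p p \<le> s + inner p q" by (simp add: d_def inner_diff)
  qed
qed

section \<open>Minty's theorem\<close>

text \<open>
  The set \<open>S\<close> in the proof is the epigraph of the Fitzpatrick function
  \<open>(x, w) \<mapsto> sup {\<langle>x, v\<rangle> + \<langle>y, w\<rangle> - \<langle>y, v\<rangle> | (y, v) \<in> G}\<close>, an intersection of closed half-spaces.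
  Maximality bounds this function below by \<open>\<langle>x, w\<rangle>\<close>, and monotonicity gives equality on \<open>G\<close>. The
  optimality condition at the minimiser \<open>(x, w)\<close> therefore reads
  \<open>\<langle>y + w, v + x\<rangle> \<ge> \<parallel>x + w\<parallel>\<^sup>2\<close> for \<open>(y, v) \<in> G\<close>. Maximality puts \<open>(-w, -x)\<close> in \<open>G\<close>, and inserting this
  pair into the inequality forces \<open>w = -x\<close>.
\<close>

lemma Minty_zero:
  fixes G :: "('h::{real_inner, complete_space} \<times> 'h) set"
  assumes mono: "\<And>x u y v. (x, u) \<in> G \<Longrightarrow> (y, v) \<in> G \<Longrightarrow> 0 \<le> inner (x - y) (u - v)"
    and max: "\<And>x u. (\<And>y v. (y, v) \<in> G \<Longrightarrow> 0 \<le> inner (x - y) (u - v)) \<Longrightarrow> (x, u) \<in> G"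
  shows "\<exists>x. (x, - x) \<in> G"
proof -
  define S :: "(('h \<times> 'h) \<times> real) set" where
    "S = (\<Inter>(y, v)\<in>G. {a. inner ((v, y), - 1) a \<le> inner y v})"
  have S_iff: "((x, w), t) \<in> S \<longleftrightarrow> (\<forall>(y, v)\<in>G. inner v x + inner y w - inner y v \<le> t)" for x w t
    by (auto simp: S_def)
  have S_ge: "inner x w \<le> t" if "((x, w), t) \<in> S" for x w t
  proof (rule ccontr)
    assume less: "\<not> inner x w \<le> t"
    have "(x, w) \<in> G"
    proof (rule max)
      fix y v assume "(y, v) \<in> G"
      with that have "inner v x + inner y w - inner y v \<le> t" by (auto simp: S_iff)
      with less show "0 \<le> inner (x - y) (w - v)" by (simp add: inner_diff inner_commute)
    qed
    with that have "inner w x + inner x w - inner x w \<le> t" by (auto simp: S_iff)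
    with less show False by (simp add: inner_commute)
  qed
  have G_S: "((y, v), inner y v) \<in> S" if "(y, v) \<in> G" for y v
    unfolding S_iff using mono[OF that] by (auto simp: inner_diff inner_commute algebra_simps)
  have "closed S"
    unfolding S_def case_prod_beta by (intro closed_INT ballI closed_halfspace_le)
  moreover have "convex S"
    unfolding S_def case_prod_beta by (intro convex_INT convex_halfspace_le)
  moreover have "S \<noteq> {}"
    \<comment> \<open>An empty graph is not maximal: every pair is monotonically related to it.\<close>
    using G_S max by blast
  moreover have "0 \<le> t + inner p p / 2" if pt: "(p, t) \<in> S" for p t
  proof -
    obtain x w where xw: "p = (x, w)" by (cases p)
    have "0 \<le> inner (x + w) (x + w)" by simp
    with S_ge[OF pt[unfolded xw]] show ?thesis
      by (simp add: xw inner_add inner_commute field_simps)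
  qed
  ultimately obtain p t where pt: "(p, t) \<in> S"
    and opt: "\<And>q s. (q, s) \<in> S \<Longrightarrow> t + inner p p \<le> s + inner p q"
    by (rule epigraph_minimiser) auto
  obtain x w where xw: "p = (x, w)" by (cases p)
  \<comment> \<open>The optimality condition tested against \<open>G\<close>, with \<open>t\<close> replaced by its lower bound \<open>\<langle>x, w\<rangle>\<close>.\<close>
  have key: "inner (x + w) (x + w) \<le> inner (y + w) (v + x)" if "(y, v) \<in> G" for y v
    using opt[OF G_S[OF that]] S_ge[OF pt[unfolded xw]]
    by (simp add: xw inner_add inner_commute)
  have "(- w, - x) \<in> G"
  proof (rule max)
    fix y v assume "(y, v) \<in> G"
    then have "0 \<le> inner (y + w) (v + x)"
      using key inner_ge_zero[of "x + w"] by (meson order_trans)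
    then show "0 \<le> inner (- w - y) (- x - v)"
      by (simp add: inner_add inner_diff algebra_simps)
  qed
  moreover from key[OF this] have "x + w = 0" by (simp flip: power2_norm_eq_inner)
  then have "w = - x" by (simp add: add_eq_0_iff)
  ultimately show ?thesis by auto
qed

lemma maximal_monotoneD:
  assumes "maximal_monotone B" and "u \<in> B x" and "v \<in> B y"
  shows "0 \<le> inner (x - y) (u - v)"
  using assms by (auto simp: maximal_monotone_def monotone_op_def)

text \<open>
  Maximality among graphs is used through points: a pair monotonically related to the graph could be
  adjoined to it, so it already belongs to it.
\<close>

lemma maximal_monotone_memI:
  assumes "maximal_monotone B" and rel: "\<And>y v. v \<in> B y \<Longrightarrow> 0 \<le> inner (x - y) (u - v)"
  shows "u \<in> B x"
proof -
  define D where "D = B(x := insert u (B x))"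
  have "0 \<le> inner (y - x) (v - u)" if "v \<in> B y" for y v
    using rel[OF that] by (simp add: inner_diff algebra_simps)
  then have "monotone_op D"
    using assms by (auto simp: D_def monotone_op_def maximal_monotone_def)
  moreover have "B \<le> D" by (auto simp: D_def le_fun_def)
  ultimately have "D = B" using assms(1) by (auto simp: maximal_monotone_def)
  then have "D x = B x" by simp
  then show ?thesis by (auto simp: D_def)
qed

text \<open>The operator \<open>B - z\<close> is again maximal monotone, so the general case reduces to the origin.\<close>

lemma Minty:
  fixes B :: "'h::{real_inner, complete_space} \<Rightarrow> 'h set"
  assumes B: "maximal_monotone B"
  shows "\<exists>p. z - p \<in> B p"
proof -
  have "\<exists>p. (p, - p) \<in> {(x, u). u + z \<in> B x}"
  proof (rule Minty_zero)
    fix x u y v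
    assume "(x, u) \<in> {(x, u). u + z \<in> B x}" "(y, v) \<in> {(x, u). u + z \<in> B x}"
    then show "0 \<le> inner (x - y) (u - v)"
      using maximal_monotoneD[OF B, of "u + z" x "v + z" y] by simp
  next
    fix x u
    assume rel: "\<And>y v. (y, v) \<in> {(x, u). u + z \<in> B x} \<Longrightarrow> 0 \<le> inner (x - y) (u - v)"
    have "u + z \<in> B x"
    proof (rule maximal_monotone_memI[OF B])
      fix y v assume "v \<in> B y"
      then show "0 \<le> inner (x - y) (u + z - v)"
        using rel[of y "v - z"] by (simp add: algebra_simps)
    qed
    then show "(x, u) \<in> {(x, u). u + z \<in> B x}" by simp
  qed
  then show ?thesis by auto
qed

section \<open>Resolvents of maximal monotone operators\<close>

lemma mem_resolvent_iff:
  fixes B :: "'h::ab_group_add \<Rightarrow> 'h set"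
  shows "p \<in> resolvent B x \<longleftrightarrow> x - p \<in> B p"
proof -
  have "x \<in> B p + {p} \<longleftrightarrow> x - p \<in> B p"
    by (auto simp: set_plus_def) (metis diff_add_cancel)
  then show ?thesis by (simp add: resolvent_def op_inverse_def op_plus_def)
qed

text \<open>
  Monotonicity applied to the two inclusions bounds \<open>\<parallel>p - q\<parallel>\<^sup>2\<close> by \<open>\<langle>p - q, x - y\<rangle>\<close>, so the
  Cauchy-Schwarz inequality gives the claim. The case \<open>x = y\<close> is single-valuedness of the resolvent.
\<close>

lemma resolvent_nonexpansive:
  fixes B :: "'h::real_inner \<Rightarrow> 'h set"
  assumes "monotone_op B" and "x - p \<in> B p" and "y - q \<in> B q"
  shows "norm (p - q) \<le> norm (x - y)"
proof -
  have "0 \<le> inner (p - q) ((x - p) - (y - q))" using assms by (auto simp: monotone_op_def)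
  also have "(x - p) - (y - q) = (x - y) - (p - q)" by simp
  finally have "norm (p - q) * norm (p - q) \<le> inner (p - q) (x - y)"
    by (simp add: inner_diff_right flip: power2_norm_eq_inner power2_eq_square)
  also have "\<dots> \<le> norm (p - q) * norm (x - y)" by (rule norm_cauchy_schwarz)
  finally show ?thesis
    by (cases "norm (p - q) = 0") (auto simp: mult_le_cancel_left)
qed

lemma resolvent_map_eqI:
  fixes B :: "'h::real_inner \<Rightarrow> 'h set"
  assumes "monotone_op B" and "x - p \<in> B p"
  shows "resolvent_map B x = p"
proof -
  have "q = p" if "x - q \<in> B q" for q
    using resolvent_nonexpansive[OF assms(1) that assms(2)] by simp
  then have "resolvent B x = {p}" using assms(2) unfolding set_eq_iff mem_resolvent_iff by blast
  then show ?thesis by (simp add: resolvent_map_def)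
qed

lemma resolvent_map_eq_iff:
  fixes B :: "'h::{real_inner, complete_space} \<Rightarrow> 'h set"
  assumes "maximal_monotone B"
  shows "resolvent_map B x = p \<longleftrightarrow> x - p \<in> B p"
proof -
  have "monotone_op B" using assms by (simp add: maximal_monotone_def)
  then show ?thesis using Minty[OF assms, of x] resolvent_map_eqI by metis
qed

lemma continuous_on_resolvent_map:
  fixes B :: "'h::{real_inner, complete_space} \<Rightarrow> 'h set"
  assumes "maximal_monotone B"
  shows "continuous_on S (resolvent_map B)"
proof -
  have mono: "monotone_op B" using assms by (simp add: maximal_monotone_def)
  have graph: "x - resolvent_map B x \<in> B (resolvent_map B x)" for x
    by (rule resolvent_map_eq_iff[OF assms, THEN iffD1, OF refl])
  have "dist (resolvent_map B x) (resolvent_map B y) \<le> dist x y" for x y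
    unfolding dist_norm by (rule resolvent_nonexpansive[OF mono graph graph])
  then have "1-lipschitz_on S (resolvent_map B)" by (intro lipschitz_onI) auto
  then show ?thesis by (rule lipschitz_on_continuous_on)
qed

lemma mem_op_divide_iff:
  assumes "c \<noteq> 0"
  shows "u \<in> op_divide B c x \<longleftrightarrow> c *\<^sub>R u \<in> B x"
  using assms by (force simp: op_divide_def image_iff)

lemma maximal_monotone_op_divide:
  assumes "maximal_monotone B" and c: "0 < c"
  shows "maximal_monotone (op_divide B c)"
proof -
  have mem: "u \<in> op_divide B c x \<longleftrightarrow> c *\<^sub>R u \<in> B x" for u x
    using c by (simp add: mem_op_divide_iff)
  have scale: "0 \<le> inner a (c *\<^sub>R b) \<longleftrightarrow> 0 \<le> inner a b" for a b :: 'a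
    using c by (simp add: zero_le_mult_iff)
  have "monotone_op (op_divide B c)"
    unfolding monotone_op_def
  proof (intro allI ballI)
    fix x y u v assume "u \<in> op_divide B c x" "v \<in> op_divide B c y"
    then have "0 \<le> inner (x - y) (c *\<^sub>R u - c *\<^sub>R v)"
      using maximal_monotoneD[OF assms(1)] by (simp add: mem)
    then show "0 \<le> inner (x - y) (u - v)"
      using scale by (simp flip: scaleR_diff_right)
  qed
  moreover have "D = op_divide B c" if D: "monotone_op D" and le: "op_divide B c \<le> D" for D
  proof -
    have "u \<in> op_divide B c x" if u: "u \<in> D x" for u x
      unfolding mem
    proof (rule maximal_monotone_memI[OF assms(1)])
      fix y v assume "v \<in> B y"
      then have "v /\<^sub>R c \<in> op_divide B c y" using c by (simp add: mem)
      with le have "v /\<^sub>R c \<in> D y" by (auto simp: le_fun_def)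
      with u D have "0 \<le> inner (x - y) (c *\<^sub>R (u - v /\<^sub>R c))"
        unfolding scale by (auto simp: monotone_op_def)
      then show "0 \<le> inner (x - y) (c *\<^sub>R u - v)" using c by (simp add: scaleR_diff_right)
    qed
    with le show ?thesis by (intro ext) (auto simp: le_fun_def)
  qed
  ultimately show ?thesis by (auto simp: maximal_monotone_def)
qed

section \<open>The displacement between the two fixed point sets\<close>

text \<open>
  The variable \<open>w\<close> runs over dual solutions: an element of the dual operator at \<open>w\<close> has the form
  \<open>a - b\<close> with \<open>w \<in> B\<^sub>1 a\<close> and \<open>-w \<in> B\<^sub>2 b\<close>. The two sign changes in \<open>op_tilde\<close> cancel, so
  pairing two such elements splits into one monotonicity inequality for \<open>B\<^sub>1\<close> and one for \<open>B\<^sub>2\<close>.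
\<close>

lemma monotone_op_dual:
  assumes "monotone_op B1" and "monotone_op B2"
  shows "monotone_op (op_plus (op_inverse B1) (op_tilde B2))"
  unfolding monotone_op_def
proof (intro allI ballI)
  fix w w' c c'
  assume "c \<in> op_plus (op_inverse B1) (op_tilde B2) w"
    and "c' \<in> op_plus (op_inverse B1) (op_tilde B2) w'"
  then obtain a b a' b' where "c = a - b" "c' = a' - b'"
    and "w \<in> B1 a" "- w \<in> B2 b" "w' \<in> B1 a'" "- w' \<in> B2 b'"
    by (auto simp: op_plus_def op_tilde_def op_inverse_def set_plus_def)
  moreover from this assms have "0 \<le> inner (a - a') (w - w')" "0 \<le> inner (b - b') (- w - - w')"
    unfolding monotone_op_def by blast+
  moreover have "inner (w - w') ((a - b) - (a' - b'))
      = inner (a - a') (w - w') + inner (b - b') (- w - - w')"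
    by (simp add: inner_diff inner_commute)
  ultimately show "0 \<le> inner (w - w') (c - c')" by simp
qed

text \<open>
  With \<open>y = J\<^bsub>B\<^sub>2\<^esub> x\<close>, the inclusions \<open>y - x \<in> B\<^sub>1 x\<close> and \<open>-(y - x) \<in> B\<^sub>2 y\<close> exhibit \<open>y - x\<close> as a
  point of the dual resolvent at the origin, and monotonicity of the dual operator allows only one
  such point, whatever \<open>x\<close> was.
\<close>

lemma displacement_eq_dual_solution:
  fixes B1 B2 :: "'h::{real_inner, complete_space} \<Rightarrow> 'h set"
  assumes B1: "maximal_monotone B1" and B2: "maximal_monotone B2"
    and x: "x \<in> Fix (resolvent_map B1 \<circ> resolvent_map B2)"
  shows "resolvent_map B2 x = x + resolvent_map (op_plus (op_inverse B1) (op_tilde B2)) 0"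
proof -
  define y where "y = resolvent_map B2 x"
  have "resolvent_map B1 y = x" using x by (simp add: Fix_def y_def)
  then have y1: "y - x \<in> B1 x" and y2: "- (y - x) \<in> B2 y"
    using resolvent_map_eq_iff[OF B1] resolvent_map_eq_iff[OF B2, of x y] by (auto simp: y_def)
  have "0 - (y - x) = x + - y" by simp
  also have "\<dots> \<in> op_plus (op_inverse B1) (op_tilde B2) (y - x)"
    unfolding op_plus_def using y1 y2
    by (intro set_plus_intro) (auto simp: op_inverse_def op_tilde_def)
  finally have "resolvent_map (op_plus (op_inverse B1) (op_tilde B2)) 0 = y - x"
    using B1 B2 by (intro resolvent_map_eqI monotone_op_dual) (auto simp: maximal_monotone_def)
  then show ?thesis by (simp add: y_def)
qed

section \<open>Fixed points of the averaged resolvent\<close>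

text \<open>
  The displacement enters only as a vector \<open>u\<close> common to all fixed points of the composition. In
  this form the lemma is symmetric under exchanging the operators and weights and negating \<open>u\<close>, so
  it covers both compositions.
\<close>

lemma Fix_average_homeomorphism:
  fixes A1 A2 :: "'h::{real_inner, complete_space} \<Rightarrow> 'h set"
  assumes A1: "maximal_monotone A1" and A2: "maximal_monotone A2"
    and l: "0 < l1" "0 < l2" "l1 + l2 = 1"
  defines "J \<equiv> \<lambda>z. l1 *\<^sub>R resolvent_map A1 z + l2 *\<^sub>R resolvent_map A2 z"
    and "E \<equiv> Fix (resolvent_map (op_divide A1 l2) \<circ> resolvent_map (op_divide A2 l1))"
    and "h \<equiv> \<lambda>x. l1 *\<^sub>R x + l2 *\<^sub>R resolvent_map (op_divide A2 l1) x"
  assumes u: "\<And>x. x \<in> E \<Longrightarrow> resolvent_map (op_divide A2 l1) x = x + u"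
  shows "(\<forall>x\<in>E. h x = x + l2 *\<^sub>R u) \<and> homeomorphism E (Fix J) h (resolvent_map A1) \<and>
    Fix J = (\<lambda>x. x + l2 *\<^sub>R u) ` E"
proof -
  have l1: "l1 = 1 - l2" using l by simp
  note RA1 = resolvent_map_eq_iff[OF A1] and RA2 = resolvent_map_eq_iff[OF A2]
  have RB1: "resolvent_map (op_divide A1 l2) x = p \<longleftrightarrow> l2 *\<^sub>R (x - p) \<in> A1 p" for x p
    using l by (simp add: resolvent_map_eq_iff maximal_monotone_op_divide A1 mem_op_divide_iff)
  have RB2: "resolvent_map (op_divide A2 l1) x = p \<longleftrightarrow> l1 *\<^sub>R (x - p) \<in> A2 p" for x p
    using l by (simp add: resolvent_map_eq_iff maximal_monotone_op_divide A2 mem_op_divide_iff)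
  have h: "h x = x + l2 *\<^sub>R u" if "x \<in> E" for x
    using u[OF that] by (simp add: h_def l1 algebra_simps)
  have to_Fix: "h x \<in> Fix J \<and> resolvent_map A1 (h x) = x" if x: "x \<in> E" for x
  proof -
    have "resolvent_map (op_divide A1 l2) (x + u) = x"
      using x u[OF x] by (simp add: E_def Fix_def)
    then have 1: "resolvent_map A1 (h x) = x" by (simp add: RA1 RB1 h[OF x])
    have "l1 *\<^sub>R (x - (x + u)) = h x - (x + u)" by (simp add: h[OF x] l1 algebra_simps)
    then have 2: "resolvent_map A2 (h x) = x + u" using u[OF x] unfolding RA2 RB2 by simp
    from 1 2 u[OF x] show ?thesis by (simp add: Fix_def J_def h_def)
  qed
  have from_Fix: "resolvent_map A1 z \<in> E \<and> h (resolvent_map A1 z) = z" if z: "z \<in> Fix J" for z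
  proof -
    define p q where "p = resolvent_map A1 z" and "q = resolvent_map A2 z"
    have zpq: "z = l1 *\<^sub>R p + l2 *\<^sub>R q" using z by (simp add: Fix_def J_def p_def q_def)
    have "z - p = l2 *\<^sub>R (q - p)" "z - q = l1 *\<^sub>R (p - q)"
      unfolding zpq l1 by (simp_all add: algebra_simps)
    moreover have "z - p \<in> A1 p" "z - q \<in> A2 q" using RA1[of z p] RA2[of z q] by (simp_all add: p_def q_def)
    ultimately have "resolvent_map (op_divide A1 l2) q = p" and
      "resolvent_map (op_divide A2 l1) p = q"
      unfolding RB1 RB2 by simp_all
    then have "p \<in> E" "h p = z" by (simp_all add: E_def Fix_def h_def zpq)
    then show ?thesis by (simp add: p_def)
  qed
  have image: "h ` E = Fix J" using to_Fix from_Fix by (metis image_subset_iff image_eqI subsetI subset_antisym)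
  have "continuous_on E h"
    by (subst continuous_on_cong[OF refl h]) (auto intro!: continuous_intros)
  then have "homeomorphism E (Fix J) h (resolvent_map A1)"
    using to_Fix from_Fix continuous_on_resolvent_map[OF A1]
    by (intro homeomorphismI image_subsetI) simp_all
  moreover have "h ` E = (\<lambda>x. x + l2 *\<^sub>R u) ` E" by (rule image_cong[OF refl h])
  ultimately show ?thesis using h image by simp
qed

theorem theorem3p8:
  fixes A1 A2 :: "'h::{real_inner, complete_space} \<Rightarrow> 'h set"
    and l1 l2 :: real
    and JA :: "'h \<Rightarrow> 'h"
    and E F :: "'h set"
    and C :: "'h \<Rightarrow> 'h set"
    and u :: 'h
  defines "JA \<equiv> \<lambda>x. l1 *\<^sub>R resolvent_map A1 x + l2 *\<^sub>R resolvent_map A2 x"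
    and "E \<equiv> Fix (resolvent_map (op_divide A1 l2) \<circ> resolvent_map (op_divide A2 l1))"
    and "F \<equiv> Fix (resolvent_map (op_divide A2 l1) \<circ> resolvent_map (op_divide A1 l2))"
    and "C \<equiv> op_plus (op_inverse (op_divide A1 l2)) (op_tilde (op_divide A2 l1))"
    and "u \<equiv> resolvent_map C 0"
  assumes "maximal_monotone A1" and "maximal_monotone A2"
    and "0 < l1" and "0 < l2" and "l1 + l2 = 1"
    and "resolvent C 0 \<noteq> {}"
  shows
    "((\<forall>x\<in>E. l1 *\<^sub>R x + l2 *\<^sub>R resolvent_map (op_divide A2 l1) x = x + l2 *\<^sub>R u) \<and>
      homeomorphism E (Fix JA)
        (\<lambda>x. l1 *\<^sub>R x + l2 *\<^sub>R resolvent_map (op_divide A2 l1) x) (resolvent_map A1) \<and>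
      Fix JA = (\<lambda>x. x + l2 *\<^sub>R u) ` E) \<and>
     ((\<forall>y\<in>F. l1 *\<^sub>R resolvent_map (op_divide A1 l2) y + l2 *\<^sub>R y = - (l1 *\<^sub>R u) + y) \<and>
      homeomorphism F (Fix JA)
        (\<lambda>y. l1 *\<^sub>R resolvent_map (op_divide A1 l2) y + l2 *\<^sub>R y) (resolvent_map A2) \<and>
      Fix JA = (\<lambda>y. y - l1 *\<^sub>R u) ` F)"
proof -
  note max = assms(6,7) and l = assms(8,9,10)
  let ?J1 = "resolvent_map (op_divide A1 l2)" and ?J2 = "resolvent_map (op_divide A2 l1)"
  have J2: "?J2 x = x + u" if "x \<in> E" for x
    using displacement_eq_dual_solution[of "op_divide A1 l2" "op_divide A2 l1"] that max l
    by (simp add: E_def u_def C_def maximal_monotone_op_divide)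
  have J1: "?J1 y = y + - u" if "y \<in> F" for y
  proof -
    have y: "?J2 (?J1 y) = y" using that by (simp add: F_def Fix_def)
    then have "?J1 y \<in> E" by (simp add: E_def Fix_def)
    with J2 y have "y = ?J1 y + u" by metis
    then show ?thesis by (metis add_diff_cancel diff_conv_add_uminus)
  qed
  have JA_swap: "JA = (\<lambda>z. l2 *\<^sub>R resolvent_map A2 z + l1 *\<^sub>R resolvent_map A1 z)"
    by (simp add: JA_def add.commute)
  show ?thesis
  proof
    show "(\<forall>x\<in>E. l1 *\<^sub>R x + l2 *\<^sub>R ?J2 x = x + l2 *\<^sub>R u) \<and>
      homeomorphism E (Fix JA) (\<lambda>x. l1 *\<^sub>R x + l2 *\<^sub>R ?J2 x) (resolvent_map A1) \<and>
      Fix JA = (\<lambda>x. x + l2 *\<^sub>R u) ` E"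
      using Fix_average_homeomorphism[OF max l, of u] J2 unfolding E_def JA_def by blast
    have "l2 + l1 = 1" using l by simp
    from Fix_average_homeomorphism[OF max(2,1) l(2,1) this, of "- u"] J1
    have "(\<forall>y\<in>F. l2 *\<^sub>R y + l1 *\<^sub>R ?J1 y = y + l1 *\<^sub>R - u) \<and>
      homeomorphism F (Fix JA) (\<lambda>y. l2 *\<^sub>R y + l1 *\<^sub>R ?J1 y) (resolvent_map A2) \<and>
      Fix JA = (\<lambda>y. y + l1 *\<^sub>R - u) ` F"
      unfolding F_def JA_swap by blast
    moreover have swap1: "l1 *\<^sub>R ?J1 y + l2 *\<^sub>R y = l2 *\<^sub>R y + l1 *\<^sub>R ?J1 y"
      and swap2: "- (l1 *\<^sub>R u) + y = y + l1 *\<^sub>R - u" and swap3: "y - l1 *\<^sub>R u = y + l1 *\<^sub>R - u" for y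
      by simp_all
    ultimately show "(\<forall>y\<in>F. l1 *\<^sub>R ?J1 y + l2 *\<^sub>R y = - (l1 *\<^sub>R u) + y) \<and>
      homeomorphism F (Fix JA) (\<lambda>y. l1 *\<^sub>R ?J1 y + l2 *\<^sub>R y) (resolvent_map A2) \<and>
      Fix JA = (\<lambda>y. y - l1 *\<^sub>R u) ` F"
      unfolding swap1 swap2 swap3 by blast
  qed
qed

end
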